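(* Let $\lambda\in\mathbb R_+$, $0\le t<t+\Delta\le T$, and consider the class of linear path-functional portfolios $\pi=\pi(\tau,X)$ (all of type I, or all of type II) investing in a universe $\mathcal U$, with fixed auxiliary portfolio $\tau$, continuous semimartingale $X$, finite feature set $\mathcal V$ and feature maps $\{\phi^\nu\}_{\nu\in\mathcal V}$, parametrized by $\{l^i_\nu\}_{i\in\mathcal U,\nu\in\mathcal V}\subset\mathbb R$. Let $\mathscr L:\mathcal U\times\mathcal V\to\{1,\dots,|\mathcal U||\mathcal V|\}$ be a bijection and $\mathbf l_{\mathscr L(i,\nu)}=l^i_\nu$. Then the following two problems are convex quadratic optimization problems in the parameters $\{l^i_\nu\}$. More precisely: 1. (returns) $$\min_\pi\ \mathrm{Var}\big(\mathcal R^{W,\pi}_{t,t+\Delta}\big)-\lambda\,\mathbb E\big(\mathcal R^{W,\pi}_{t,t+\Delta}\big)\iff\min_{\mathbf l}\ \mathbf l^{\mathsf T}\mathrm{Var}(\mathbf Y^W)\mathbf l-\mathbf l^{\mathsf T}\big(\lambda\mathbb E(\mathbf Y^W)-\boldsymbol\sigma^W\big),$$ where $\boldsymbol\sigma^W_{\mathscr L(i,\nu)}=2\,\mathrm{Cov}(\mathbf Y^W_{\mathscr L(i,\nu)},\mathcal R^{W,\tau}_{t,t+\Delta})$ and $$\mathbf Y^W_{\mathscr L(i,\nu)}=\begin{cases}\tau^i_t\,\phi^\nu(t,X_{[0,t]})\Big(\frac{S^i_{t+\Delta}}{S^i_t}-\mathcal R^{W,\tau}_{t,t+\Delta}-1\Big)&\text{type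 I}\\[1mm]\phi^\nu(t,X_{[0,t]})\Big(\frac{S^i_{t+\Delta}}{S^i_t}-\mathcal R^{W,\tau}_{t,t+\Delta}-1\Big)&\text{type II.}\end{cases}$$ 2. (relative returns) $$\min_\pi\ \mathrm{Var}\big(\mathcal R^{V,\pi}_{t,t+\Delta}\big)-\lambda\,\mathbb E\big(\mathcal R^{V,\pi}_{t,t+\Delta}\big)\iff\min_{\mathbf l}\ \mathbf l^{\mathsf T}\mathrm{Var}(\mathbf Y^V)\mathbf l-\mathbf l^{\mathsf T}\big(\lambda\mathbb E(\mathbf Y^V)-\boldsymbol\sigma^V\big),$$ where $\boldsymbol\sigma^V_{\mathscr L(i,\nu)}=2\,\mathrm{Cov}(\mathbf Y^V_{\mathscr L(i,\nu)},\mathcal R^{V,\tau}_{t,t+\Delta})$ and $\mathbf Y^V$ is defined as $\mathbf Y^W$ with $S^i$ replaced by $\mu^{\mathcal U,i}$ and $\mathcal R^{W,\tau}$ replaced by $\mathcal R^{V,\tau}$. Here $\mathrm{Var}(\mathbf Y)$ denotes the covariance matrix of the random vector $\mathbf Y$, and "$\iff$" means that $\pi$ solves the left problem if and only if its parameter vector $\mathbf l$ solves the right one.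
   Context: There are $d$ stocks with positive continuous semimartingale capitalizations $S^1,\dots,S^d$ on a filtered probability space over $[0,T]$. A universe is a subset $\mathcal U\subseteq\{1,\dots,d\}$; its universe weights are $\mu^{\mathcal U,i}_t=S^i_t/\sum_{j\in\mathcal U}S^j_t$ for $i\in\mathcal U$ and $0$ otherwise. A portfolio $\pi$ is a vector of predictable processes with $\sum_{i=1}^d\pi^i_t\equiv1$ (integrable with respect to $R^i_t=\int_0^tdS^i_u/S^i_u$); it invests in $\mathcal U$ if $\pi^i\equiv0$ for $i\notin\mathcal U$. The auxiliary portfolio $\tau$ is a uniformly bounded portfolio investing in $\mathcal U$. A linear path-functional portfolio $\pi(\tau,X)$ investing in $\mathcal U$ has controlling functions $f^i(t,X_{[0,t]})=\sum_{\nu\in\mathcal V}l^i_\nu\phi^\nu(t,X_{[0,t]})$, $i\in\mathcal U$ ($f^i\equiv0$ for $i\notin\mathcal U$), with $\phi^\nu$ non-anticipative path functionals (functions of $t$ and of the path of $X$ on $[0,t]$) and constants $l^i_\nu\in\mathbb R$, and weights type I: $\pi^i_t=\tau^i_t\big(f^i(t,X_{[0,t]})+1-\sum_{j\in\mathcal U}\tau^j_tf^j(t,X_{[0,t]})\big)$; type II: $\pi^i_t=f^i(t,X_{[0,t]})+\tau^i_t\big(1-\sum_{j\in\mathcal U}f^j(t,X_{[0,t]})\big)$. Investing at time $t$ with weights $\pi_t$ and holding until $t+\Delta$ gives the return $\mathcal R^{W,\pi}_{t,t+\Delta}=\sum_{j\in\mathcal U}\pi^j_t\frac{S^j_{t+\Delta}}{S^j_t}-1$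 and the relative return (with respect to the universe portfolio) $\mathcal R^{V,\pi}_{t,t+\Delta}=\sum_{j\in\mathcal U}\pi^j_t\frac{\mu^{\mathcal U,j}_{t+\Delta}}{\mu^{\mathcal U,j}_t}-1$. All expectations, variances and covariances appearing are assumed finite. A convex quadratic optimization problem is the minimization of $\mathbf l^{\mathsf T}A\mathbf l+b^{\mathsf T}\mathbf l$ with $A$ symmetric positive semidefinite. *)

theory Defs
  imports "HOL-Probability.Probability" "Jordan_Normal_Form.Matrix"
begin

section \<open>Stochastic processes on a finite horizon\<close>

text \<open>Processes are maps \<open>real \<Rightarrow> 'w \<Rightarrow> _\<close> (time, scenario); only their values at times in
  \<open>{0..T}\<close> matter. Path properties of semimartingales are required almost surely, and no
  completeness or right-continuity of the filtration is imposed.\<close>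

locale filtered_prob_space = prob_space M for M :: "'w measure" +
  fixes F :: "real \<Rightarrow> 'w measure" and T :: real
  assumes subalgebra_filtration: "\<And>t. t \<in> {0..T} \<Longrightarrow> subalgebra M (F t)"
    and filtration_mono: "\<And>s t. 0 \<le> s \<Longrightarrow> s \<le> t \<Longrightarrow> t \<le> T \<Longrightarrow> sets (F s) \<subseteq> sets (F t)"

definition adapted :: "(real \<Rightarrow> 'w measure) \<Rightarrow> real \<Rightarrow> (real \<Rightarrow> 'w \<Rightarrow> real) \<Rightarrow> bool" where
  "adapted F T Z \<longleftrightarrow> (\<forall>t\<in>{0..T}. Z t \<in> borel_measurable (F t))"

definition continuous_paths :: "'w measure \<Rightarrow> real \<Rightarrow> (real \<Rightarrow> 'w \<Rightarrow> real) \<Rightarrow> bool" where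
  "continuous_paths M T Z \<longleftrightarrow> (AE \<omega> in M. continuous_on {0..T} (\<lambda>t. Z t \<omega>))"

definition predictable_sigma ::
    "'w measure \<Rightarrow> (real \<Rightarrow> 'w measure) \<Rightarrow> real \<Rightarrow> (real \<times> 'w) measure" where
  "predictable_sigma M F T = sigma ({0..T} \<times> space M)
     ({{0} \<times> A | A. A \<in> sets (F 0)} \<union>
      {{s<..t} \<times> A | s t A. 0 \<le> s \<and> s \<le> t \<and> t \<le> T \<and> A \<in> sets (F s)})"

definition predictable ::
    "'w measure \<Rightarrow> (real \<Rightarrow> 'w measure) \<Rightarrow> real \<Rightarrow> (real \<Rightarrow> 'w \<Rightarrow> real) \<Rightarrow> bool" where
  "predictable M F T H \<longleftrightarrow> (\<lambda>(t, \<omega>). H t \<omega>) \<in> borel_measurable (predictable_sigma M F T)"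

definition martingale_upto ::
    "'w measure \<Rightarrow> (real \<Rightarrow> 'w measure) \<Rightarrow> real \<Rightarrow> (real \<Rightarrow> 'w \<Rightarrow> real) \<Rightarrow> bool" where
  "martingale_upto M F T Z \<longleftrightarrow> adapted F T Z \<and> (\<forall>t\<in>{0..T}. integrable M (Z t)) \<and>
     (\<forall>s t. 0 \<le> s \<longrightarrow> s \<le> t \<longrightarrow> t \<le> T \<longrightarrow> (AE \<omega> in M. real_cond_exp M (F s) (Z t) \<omega> = Z s \<omega>))"

text \<open>A stopping time that has not occurred by time \<open>T\<close> is encoded by a value beyond \<open>T\<close>.\<close>

definition stopping_time_upto ::
    "'w measure \<Rightarrow> (real \<Rightarrow> 'w measure) \<Rightarrow> real \<Rightarrow> ('w \<Rightarrow> real) \<Rightarrow> bool" where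
  "stopping_time_upto M F T \<rho> \<longleftrightarrow> (\<forall>\<omega>\<in>space M. 0 \<le> \<rho> \<omega>) \<and>
     (\<forall>t\<in>{0..T}. {\<omega> \<in> space M. \<rho> \<omega> \<le> t} \<in> sets (F t))"

definition continuous_local_martingale ::
    "'w measure \<Rightarrow> (real \<Rightarrow> 'w measure) \<Rightarrow> real \<Rightarrow> (real \<Rightarrow> 'w \<Rightarrow> real) \<Rightarrow> bool" where
  "continuous_local_martingale M F T Z \<longleftrightarrow> adapted F T Z \<and> continuous_paths M T Z \<and>
     (\<exists>\<rho> :: nat \<Rightarrow> 'w \<Rightarrow> real.
        (\<forall>n. stopping_time_upto M F T (\<rho> n)) \<and>
        (\<forall>n. AE \<omega> in M. \<rho> n \<omega> \<le> \<rho> (Suc n) \<omega>) \<and>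
        (AE \<omega> in M. \<exists>n. T \<le> \<rho> n \<omega>) \<and>
        (\<forall>n. martingale_upto M F T (\<lambda>t \<omega>. Z (min t (\<rho> n \<omega>)) \<omega> - Z 0 \<omega>)))"

definition variation_sums :: "(real \<Rightarrow> real) \<Rightarrow> real \<Rightarrow> real set" where
  "variation_sums a t = {(\<Sum>k<n. \<bar>a (p (Suc k)) - a (p k)\<bar>) | n (p :: nat \<Rightarrow> real).
     p 0 = 0 \<and> p n = t \<and> (\<forall>k<n. p k \<le> p (Suc k))}"

definition total_variation :: "(real \<Rightarrow> real) \<Rightarrow> real \<Rightarrow> real" where
  "total_variation a t = Sup (variation_sums a t)"

definition continuous_finite_variation ::
    "'w measure \<Rightarrow> (real \<Rightarrow> 'w measure) \<Rightarrow> real \<Rightarrow> (real \<Rightarrow> 'w \<Rightarrow> real) \<Rightarrow> bool" where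
  "continuous_finite_variation M F T B \<longleftrightarrow> adapted F T B \<and> continuous_paths M T B \<and>
     (AE \<omega> in M. bdd_above (variation_sums (\<lambda>t. B t \<omega>) T))"

definition semimartingale_decomposition ::
    "'w measure \<Rightarrow> (real \<Rightarrow> 'w measure) \<Rightarrow> real \<Rightarrow> (real \<Rightarrow> 'w \<Rightarrow> real) \<Rightarrow>
     (real \<Rightarrow> 'w \<Rightarrow> real) \<Rightarrow> (real \<Rightarrow> 'w \<Rightarrow> real) \<Rightarrow> bool" where
  "semimartingale_decomposition M F T Z N B \<longleftrightarrow>
     continuous_local_martingale M F T N \<and> continuous_finite_variation M F T B \<and>
     (AE \<omega> in M. N 0 \<omega> = 0 \<and> B 0 \<omega> = 0 \<and> (\<forall>t\<in>{0..T}. Z t \<omega> = Z 0 \<omega> + N t \<omega> + B t \<omega>))"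

definition continuous_semimartingale ::
    "'w measure \<Rightarrow> (real \<Rightarrow> 'w measure) \<Rightarrow> real \<Rightarrow> (real \<Rightarrow> 'w \<Rightarrow> real) \<Rightarrow> bool" where
  "continuous_semimartingale M F T Z \<longleftrightarrow> adapted F T Z \<and> continuous_paths M T Z \<and>
     (\<exists>N B. semimartingale_decomposition M F T Z N B)"

definition tends_in_probability ::
    "'w measure \<Rightarrow> (nat \<Rightarrow> 'w \<Rightarrow> real) \<Rightarrow> ('w \<Rightarrow> real) \<Rightarrow> bool" where
  "tends_in_probability M Zn Z \<longleftrightarrow>
     (\<forall>\<epsilon>>0. (\<lambda>n. measure M {\<omega> \<in> space M. \<bar>Zn n \<omega> - Z \<omega>\<bar> > \<epsilon>}) \<longlonglongrightarrow> 0)"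

text \<open>The process \<open>Q\<close> is the quadratic variation \<open>[Z]\<close>. Uniform partitions of \<open>[0,t]\<close> suffice:
  their limits at every \<open>t\<close>, together with path continuity, determine \<open>Q\<close> up to
  indistinguishability. The same remark applies to \<open>return_process\<close> below.\<close>

definition quadratic_variation ::
    "'w measure \<Rightarrow> (real \<Rightarrow> 'w measure) \<Rightarrow> real \<Rightarrow> (real \<Rightarrow> 'w \<Rightarrow> real) \<Rightarrow>
     (real \<Rightarrow> 'w \<Rightarrow> real) \<Rightarrow> bool" where
  "quadratic_variation M F T Z Q \<longleftrightarrow> adapted F T Q \<and> continuous_paths M T Q \<and>
     (AE \<omega> in M. mono_on {0..T} (\<lambda>t. Q t \<omega>)) \<and>
     (\<forall>t\<in>{0..T}. tends_in_probability M
        (\<lambda>n \<omega>. \<Sum>k<n. (Z (t * real (Suc k) / real n) \<omega> - Z (t * real k / real n) \<omega>)\<^sup>2) (Q t))"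

text \<open>\<open>R = \<integral> dS / S\<close>, as the limit of its non-anticipating Riemann sums.\<close>

definition return_process ::
    "'w measure \<Rightarrow> (real \<Rightarrow> 'w measure) \<Rightarrow> real \<Rightarrow> (real \<Rightarrow> 'w \<Rightarrow> real) \<Rightarrow>
     (real \<Rightarrow> 'w \<Rightarrow> real) \<Rightarrow> bool" where
  "return_process M F T S R \<longleftrightarrow> continuous_semimartingale M F T R \<and>
     (\<forall>t\<in>{0..T}. tends_in_probability M
        (\<lambda>n \<omega>. \<Sum>k<n. (S (t * real (Suc k) / real n) \<omega> - S (t * real k / real n) \<omega>)
                 / S (t * real k / real n) \<omega>) (R t))"

text \<open>Lebesgue--Stieltjes measure of a continuous nondecreasing function on \<open>[0,T]\<close>, extended
  constantly to the real line.\<close>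

definition stieltjes_measure :: "real \<Rightarrow> (real \<Rightarrow> real) \<Rightarrow> real measure" where
  "stieltjes_measure T g = interval_measure (\<lambda>s. g (max 0 (min s T)))"

text \<open>A predictable \<open>H\<close> is integrable with respect to the continuous semimartingale
  \<open>Z = Z\<^sub>0 + N + B\<close> iff \<open>\<integral> H\<^sup>2 d[Z]\<close> and \<open>\<integral> \<bar>H\<bar> \<bar>dB\<bar>\<close> are finite almost surely; note
  \<open>[Z] = [N]\<close>. Decomposition and bracket are unique up to indistinguishability.\<close>

definition semimartingale_integrable ::
    "'w measure \<Rightarrow> (real \<Rightarrow> 'w measure) \<Rightarrow> real \<Rightarrow> (real \<Rightarrow> 'w \<Rightarrow> real) \<Rightarrow>
     (real \<Rightarrow> 'w \<Rightarrow> real) \<Rightarrow> bool" where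
  "semimartingale_integrable M F T Z H \<longleftrightarrow>
     (\<exists>N B Q. semimartingale_decomposition M F T Z N B \<and> quadratic_variation M F T Z Q \<and>
        (AE \<omega> in M.
           (\<integral>\<^sup>+s\<in>{0..T}. ennreal ((H s \<omega>)\<^sup>2) \<partial>stieltjes_measure T (\<lambda>s. Q s \<omega>)) < \<infinity> \<and>
           (\<integral>\<^sup>+s\<in>{0..T}. ennreal \<bar>H s \<omega>\<bar>
              \<partial>stieltjes_measure T (total_variation (\<lambda>s. B s \<omega>))) < \<infinity>))"


section \<open>Portfolios\<close>

definition positive_continuous_semimartingale ::
    "'w measure \<Rightarrow> (real \<Rightarrow> 'w measure) \<Rightarrow> real \<Rightarrow> (real \<Rightarrow> 'w \<Rightarrow> real) \<Rightarrow> bool" where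
  "positive_continuous_semimartingale M F T Z \<longleftrightarrow>
     continuous_semimartingale M F T Z \<and> (AE \<omega> in M. \<forall>t\<in>{0..T}. 0 < Z t \<omega>)"

definition continuous_semimartingale_vec ::
    "'w measure \<Rightarrow> (real \<Rightarrow> 'w measure) \<Rightarrow> real \<Rightarrow> (real \<Rightarrow> 'w \<Rightarrow> 'x::euclidean_space) \<Rightarrow> bool" where
  "continuous_semimartingale_vec M F T X \<longleftrightarrow>
     (\<forall>b\<in>Basis. continuous_semimartingale M F T (\<lambda>t \<omega>. inner (X t \<omega>) b))"

definition universe_weight ::
    "nat set \<Rightarrow> (nat \<Rightarrow> real \<Rightarrow> 'w \<Rightarrow> real) \<Rightarrow> nat \<Rightarrow> real \<Rightarrow> 'w \<Rightarrow> real" where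
  "universe_weight U S i t \<omega> = (if i \<in> U then S i t \<omega> / (\<Sum>j\<in>U. S j t \<omega>) else 0)"

text \<open>\<open>R i\<close> is the return process of stock \<open>i\<close>.\<close>

definition portfolio ::
    "'w measure \<Rightarrow> (real \<Rightarrow> 'w measure) \<Rightarrow> real \<Rightarrow> nat \<Rightarrow> (nat \<Rightarrow> real \<Rightarrow> 'w \<Rightarrow> real) \<Rightarrow>
     (nat \<Rightarrow> real \<Rightarrow> 'w \<Rightarrow> real) \<Rightarrow> bool" where
  "portfolio M F T d R \<pi> \<longleftrightarrow>
     (\<forall>i\<in>{1..d}. predictable M F T (\<pi> i) \<and> semimartingale_integrable M F T (R i) (\<pi> i)) \<and>
     (\<forall>t\<in>{0..T}. \<forall>\<omega>\<in>space M. (\<Sum>i=1..d. \<pi> i t \<omega>) = 1)"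

definition invests_in ::
    "'w measure \<Rightarrow> real \<Rightarrow> nat \<Rightarrow> nat set \<Rightarrow> (nat \<Rightarrow> real \<Rightarrow> 'w \<Rightarrow> real) \<Rightarrow> bool" where
  "invests_in M T d U \<pi> \<longleftrightarrow> (\<forall>i\<in>{1..d} - U. \<forall>t\<in>{0..T}. \<forall>\<omega>\<in>space M. \<pi> i t \<omega> = 0)"

definition uniformly_bounded_portfolio ::
    "'w measure \<Rightarrow> real \<Rightarrow> nat \<Rightarrow> (nat \<Rightarrow> real \<Rightarrow> 'w \<Rightarrow> real) \<Rightarrow> bool" where
  "uniformly_bounded_portfolio M T d \<pi> \<longleftrightarrow>
     (\<exists>C. \<forall>i\<in>{1..d}. \<forall>t\<in>{0..T}. \<forall>\<omega>\<in>space M. \<bar>\<pi> i t \<omega>\<bar> \<le> C)"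

text \<open>\<open>X\<^bsub>[0,t]\<^esub>\<close> is the restriction of the path to \<open>{0..t}\<close>. Path functionals
  \<open>\<phi> \<nu> t x\<close> are only ever applied to such restrictions, which makes them non-anticipative.\<close>

definition path_upto :: "(real \<Rightarrow> 'w \<Rightarrow> 'x) \<Rightarrow> real \<Rightarrow> 'w \<Rightarrow> real \<Rightarrow> 'x" where
  "path_upto X t \<omega> = restrict (\<lambda>s. X s \<omega>) {0..t}"

definition controlling_function ::
    "nat set \<Rightarrow> 'v set \<Rightarrow> ('v \<Rightarrow> real \<Rightarrow> (real \<Rightarrow> 'x) \<Rightarrow> real) \<Rightarrow> (nat \<Rightarrow> 'v \<Rightarrow> real) \<Rightarrow>
     nat \<Rightarrow> real \<Rightarrow> (real \<Rightarrow> 'x) \<Rightarrow> real" where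
  "controlling_function U V \<phi> l i t x = (if i \<in> U then \<Sum>\<nu>\<in>V. l i \<nu> * \<phi> \<nu> t x else 0)"

datatype portfolio_type = TypeI | TypeII

fun path_functional_weights ::
    "portfolio_type \<Rightarrow> nat set \<Rightarrow> (nat \<Rightarrow> real \<Rightarrow> 'w \<Rightarrow> real) \<Rightarrow> (real \<Rightarrow> 'w \<Rightarrow> 'x) \<Rightarrow>
     (nat \<Rightarrow> real \<Rightarrow> (real \<Rightarrow> 'x) \<Rightarrow> real) \<Rightarrow> nat \<Rightarrow> real \<Rightarrow> 'w \<Rightarrow> real" where
  "path_functional_weights TypeI U \<tau> X f i t \<omega> =
     \<tau> i t \<omega> * (f i t (path_upto X t \<omega>) + 1 - (\<Sum>j\<in>U. \<tau> j t \<omega> * f j t (path_upto X t \<omega>)))"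
| "path_functional_weights TypeII U \<tau> X f i t \<omega> =
     f i t (path_upto X t \<omega>) + \<tau> i t \<omega> * (1 - (\<Sum>j\<in>U. f j t (path_upto X t \<omega>)))"

definition linear_weights ::
    "portfolio_type \<Rightarrow> nat set \<Rightarrow> 'v set \<Rightarrow> (nat \<Rightarrow> real \<Rightarrow> 'w \<Rightarrow> real) \<Rightarrow> (real \<Rightarrow> 'w \<Rightarrow> 'x) \<Rightarrow>
     ('v \<Rightarrow> real \<Rightarrow> (real \<Rightarrow> 'x) \<Rightarrow> real) \<Rightarrow> (nat \<Rightarrow> 'v \<Rightarrow> real) \<Rightarrow> nat \<Rightarrow> real \<Rightarrow> 'w \<Rightarrow> real" where
  "linear_weights ty U V \<tau> X \<phi> l =
     path_functional_weights ty U \<tau> X (controlling_function U V \<phi> l)"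

definition linear_path_portfolios ::
    "'w measure \<Rightarrow> (real \<Rightarrow> 'w measure) \<Rightarrow> real \<Rightarrow> nat \<Rightarrow> (nat \<Rightarrow> real \<Rightarrow> 'w \<Rightarrow> real) \<Rightarrow>
     portfolio_type \<Rightarrow> nat set \<Rightarrow> 'v set \<Rightarrow> (nat \<Rightarrow> real \<Rightarrow> 'w \<Rightarrow> real) \<Rightarrow> (real \<Rightarrow> 'w \<Rightarrow> 'x) \<Rightarrow>
     ('v \<Rightarrow> real \<Rightarrow> (real \<Rightarrow> 'x) \<Rightarrow> real) \<Rightarrow> (nat \<Rightarrow> real \<Rightarrow> 'w \<Rightarrow> real) set" where
  "linear_path_portfolios M F T d R ty U V \<tau> X \<phi> =
     {\<pi>. portfolio M F T d R \<pi> \<and> invests_in M T d U \<pi> \<and> (\<exists>l. \<pi> = linear_weights ty U V \<tau> X \<phi> l)}"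


section \<open>Returns and the mean-variance problems\<close>

text \<open>With \<open>P = S\<close> this is the return of \<open>\<pi>\<close>, with \<open>P = universe_weight U S\<close> its return relative
  to the universe portfolio; likewise for \<open>feature_return\<close>.\<close>

definition holding_return ::
    "nat set \<Rightarrow> (nat \<Rightarrow> real \<Rightarrow> 'w \<Rightarrow> real) \<Rightarrow> real \<Rightarrow> real \<Rightarrow> (nat \<Rightarrow> real \<Rightarrow> 'w \<Rightarrow> real) \<Rightarrow> 'w \<Rightarrow> real" where
  "holding_return U P t \<Delta> \<pi> \<omega> = (\<Sum>j\<in>U. \<pi> j t \<omega> * (P j (t + \<Delta>) \<omega> / P j t \<omega>)) - 1"

fun feature_return ::
    "portfolio_type \<Rightarrow> nat set \<Rightarrow> (nat \<Rightarrow> real \<Rightarrow> 'w \<Rightarrow> real) \<Rightarrow> (nat \<Rightarrow> real \<Rightarrow> 'w \<Rightarrow> real) \<Rightarrow>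
     (real \<Rightarrow> 'w \<Rightarrow> 'x) \<Rightarrow> ('v \<Rightarrow> real \<Rightarrow> (real \<Rightarrow> 'x) \<Rightarrow> real) \<Rightarrow> real \<Rightarrow> real \<Rightarrow>
     nat \<Rightarrow> 'v \<Rightarrow> 'w \<Rightarrow> real" where
  "feature_return TypeI U P \<tau> X \<phi> t \<Delta> i \<nu> \<omega> = \<tau> i t \<omega> * \<phi> \<nu> t (path_upto X t \<omega>) *
     (P i (t + \<Delta>) \<omega> / P i t \<omega> - holding_return U P t \<Delta> \<tau> \<omega> - 1)"
| "feature_return TypeII U P \<tau> X \<phi> t \<Delta> i \<nu> \<omega> = \<phi> \<nu> t (path_upto X t \<omega>) *
     (P i (t + \<Delta>) \<omega> / P i t \<omega> - holding_return U P t \<Delta> \<tau> \<omega> - 1)"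

text \<open>\<open>stack U V \<L> a\<close> is the vector with \<open>\<L> (i, \<nu>)\<close>-th entry \<open>a i \<nu>\<close>. The values of \<open>\<L>\<close> count
  from 1, the entries of \<^typ>\<open>real vec\<close> from 0.\<close>

definition stack :: "nat set \<Rightarrow> 'v set \<Rightarrow> (nat \<times> 'v \<Rightarrow> nat) \<Rightarrow> (nat \<Rightarrow> 'v \<Rightarrow> real) \<Rightarrow> real vec" where
  "stack U V \<L> a =
     Matrix.vec (card U * card V) (\<lambda>k. case inv_into (U \<times> V) \<L> (Suc k) of (i, \<nu>) \<Rightarrow> a i \<nu>)"

lemma stack_index:
  assumes "bij_betw \<L> (U \<times> V) {1..card U * card V}" "i \<in> U" "\<nu> \<in> V"
  shows "vec_index (stack U V \<L> a) (\<L> (i, \<nu>) - 1) = a i \<nu>"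
proof -
  have "\<L> (i, \<nu>) \<in> {1..card U * card V}"
    using assms by (blast dest: bij_betwE)
  then have "\<L> (i, \<nu>) - 1 < card U * card V" "Suc (\<L> (i, \<nu>) - 1) = \<L> (i, \<nu>)"
    by auto
  moreover have "inv_into (U \<times> V) \<L> (\<L> (i, \<nu>)) = (i, \<nu>)"
    using assms by (auto simp: bij_betw_def intro: inv_into_f_f)
  ultimately show ?thesis
    unfolding stack_def by (simp only: index_vec prod.case)
qed

definition square_integrable :: "'w measure \<Rightarrow> ('w \<Rightarrow> real) \<Rightarrow> bool" where
  "square_integrable M Z \<longleftrightarrow> Z \<in> borel_measurable M \<and> integrable M (\<lambda>\<omega>. (Z \<omega>)\<^sup>2)"

definition covariance :: "'w measure \<Rightarrow> ('w \<Rightarrow> real) \<Rightarrow> ('w \<Rightarrow> real) \<Rightarrow> real" where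
  "covariance M Y Z = prob_space.expectation M
     (\<lambda>\<omega>. (Y \<omega> - prob_space.expectation M Y) * (Z \<omega> - prob_space.expectation M Z))"

definition mean_vec :: "'w measure \<Rightarrow> nat \<Rightarrow> ('w \<Rightarrow> real vec) \<Rightarrow> real vec" where
  "mean_vec M n Y = Matrix.vec n (\<lambda>k. prob_space.expectation M (\<lambda>\<omega>. vec_index (Y \<omega>) k))"

definition covariance_mat :: "'w measure \<Rightarrow> nat \<Rightarrow> ('w \<Rightarrow> real vec) \<Rightarrow> real mat" where
  "covariance_mat M n Y = Matrix.mat n n
     (\<lambda>(p, q). covariance M (\<lambda>\<omega>. vec_index (Y \<omega>) p) (\<lambda>\<omega>. vec_index (Y \<omega>) q))"

definition sigma_vec :: "'w measure \<Rightarrow> nat \<Rightarrow> ('w \<Rightarrow> real vec) \<Rightarrow> ('w \<Rightarrow> real) \<Rightarrow> real vec" where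
  "sigma_vec M n Y Z = Matrix.vec n (\<lambda>k. 2 * covariance M (\<lambda>\<omega>. vec_index (Y \<omega>) k) Z)"

definition portfolio_objective :: "'w measure \<Rightarrow> real \<Rightarrow> ('w \<Rightarrow> real) \<Rightarrow> real" where
  "portfolio_objective M lam Z = prob_space.variance M Z - lam * prob_space.expectation M Z"

definition parameter_objective ::
    "'w measure \<Rightarrow> real \<Rightarrow> nat \<Rightarrow> ('w \<Rightarrow> real vec) \<Rightarrow> ('w \<Rightarrow> real) \<Rightarrow> real vec \<Rightarrow> real" where
  "parameter_objective M lam n Y Z x =
     scalar_prod x (covariance_mat M n Y *\<^sub>v x)
     - scalar_prod x (lam \<cdot>\<^sub>v mean_vec M n Y - sigma_vec M n Y Z)"

definition positive_semidefinite :: "nat \<Rightarrow> real mat \<Rightarrow> bool" where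
  "positive_semidefinite n A \<longleftrightarrow> A \<in> carrier_mat n n \<and> transpose_mat A = A \<and>
     (\<forall>x\<in>carrier_vec n. 0 \<le> scalar_prod x (A *\<^sub>v x))"

text \<open>The unconstrained problem of minimizing \<open>q\<close> over \<open>carrier_vec n\<close> is a convex quadratic
  optimization problem.\<close>

definition convex_quadratic_problem :: "nat \<Rightarrow> (real vec \<Rightarrow> real) \<Rightarrow> bool" where
  "convex_quadratic_problem n q \<longleftrightarrow>
     (\<exists>A b. positive_semidefinite n A \<and> b \<in> carrier_vec n \<and>
        (\<forall>x\<in>carrier_vec n. q x = scalar_prod x (A *\<^sub>v x) + scalar_prod b x))"

end

theory Submission
  imports Defs
begin

text \<open>The return of a linear path-functional portfolio is affine in its parameters: it equals the
  return of \<open>\<tau>\<close> plus \<open>\<Sum> l i \<nu> * Y i \<nu>\<close>. Expanding the variance bilinearly, the portfolio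
  objective is the parameter objective plus the constant objective of \<open>\<tau>\<close>; the quadratic part is
  the variance of a linear combination of the \<open>Y i \<nu>\<close>, hence nonnegative.\<close>

section \<open>Square-integrable random variables as a vector space\<close>

lemma square_integrable_measurable:
  "square_integrable M Z \<Longrightarrow> Z \<in> borel_measurable M"
  by (simp add: square_integrable_def)

lemma square_integrable_mult_integrable:
  assumes "square_integrable M Y" "square_integrable M Z"
  shows "integrable M (\<lambda>\<omega>. Y \<omega> * Z \<omega>)"
proof (rule Bochner_Integration.integrable_bound)
  show "integrable M (\<lambda>\<omega>. (Y \<omega>)\<^sup>2 + (Z \<omega>)\<^sup>2)"
    using assms by (simp add: square_integrable_def)
  show "(\<lambda>\<omega>. Y \<omega> * Z \<omega>) \<in> borel_measurable M"
    using assms[THEN square_integrable_measurable] by simp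
  \<comment> \<open>The elementary bound gives 2|y||z| on the left; dropping one nonnegative copy of
    |y||z| leaves a dominating function that is integrable by assumption.\<close>
  have "\<bar>y * z\<bar> \<le> y\<^sup>2 + z\<^sup>2" for y z :: real
    using sum_squares_bound[of "\<bar>y\<bar>" "\<bar>z\<bar>"] mult_nonneg_nonneg[of "\<bar>y\<bar>" "\<bar>z\<bar>"]
    unfolding abs_mult power2_abs by linarith
  then show "AE \<omega> in M. norm (Y \<omega> * Z \<omega>) \<le> norm ((Y \<omega>)\<^sup>2 + (Z \<omega>)\<^sup>2)"
    by simp
qed

lemma square_integrable_add:
  assumes "square_integrable M Y" "square_integrable M Z"
  shows "square_integrable M (\<lambda>\<omega>. Y \<omega> + Z \<omega>)"
proof -
  have "integrable M (\<lambda>\<omega>. (Y \<omega>)\<^sup>2 + (Z \<omega>)\<^sup>2 + 2 * (Y \<omega> * Z \<omega>))"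
    using assms square_integrable_mult_integrable[OF assms]
    by (auto simp: square_integrable_def)
  then show ?thesis
    using assms[THEN square_integrable_measurable]
    by (simp add: square_integrable_def power2_sum mult.assoc)
qed

lemma square_integrable_cmult:
  "square_integrable M Z \<Longrightarrow> square_integrable M (\<lambda>\<omega>. c * Z \<omega>)"
  by (auto simp: square_integrable_def power_mult_distrib)

lemma square_integrable_sum:
  assumes "\<And>i. i \<in> I \<Longrightarrow> square_integrable M (Y i)"
  shows "square_integrable M (\<lambda>\<omega>. \<Sum>i\<in>I. Y i \<omega>)"
  using assms
  \<comment> \<open>For infinite \<open>I\<close> the sum defaults to 0, so that case and the empty
    one concern the zero function.\<close>
  by (induction I rule: infinite_finite_induct)
    (auto intro: square_integrable_add, auto simp: square_integrable_def)

section \<open>Covariance as a bilinear form, and the mean-variance objective\<close>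

context prob_space
begin

lemma integrable_if_square_integrable:
  "square_integrable M Z \<Longrightarrow> integrable M Z"
  by (rule square_integrable_imp_integrable) (auto simp: square_integrable_def)

text \<open>Expanding the product of the centred variables leaves integrable terms only, and total
  mass 1 makes the expectation of a constant that constant. In this form bilinearity follows from
  linearity of the expectation.\<close>

lemma covariance_eq_expectation_mult:
  assumes "square_integrable M Y" "square_integrable M Z"
  shows "covariance M Y Z = expectation (\<lambda>\<omega>. Y \<omega> * Z \<omega>) - expectation Y * expectation Z"
  using square_integrable_mult_integrable[OF assms] assms[THEN integrable_if_square_integrable]
  by (simp add: covariance_def algebra_simps prob_space)

lemma variance_eq_covariance: "variance Z = covariance M Z Z"
  by (simp add: covariance_def power2_eq_square)

lemma covariance_commute: "covariance M Y Z = covariance M Z Y"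
  by (simp add: covariance_def mult.commute)

lemma covariance_add_left:
  assumes "square_integrable M X" "square_integrable M Y" "square_integrable M Z"
  shows "covariance M (\<lambda>\<omega>. X \<omega> + Y \<omega>) Z = covariance M X Z + covariance M Y Z"
  using assms square_integrable_mult_integrable[OF assms(1,3)]
    square_integrable_mult_integrable[OF assms(2,3)]
  by (simp add: covariance_eq_expectation_mult square_integrable_add
      integrable_if_square_integrable algebra_simps)

lemma covariance_add_right:
  assumes "square_integrable M X" "square_integrable M Y" "square_integrable M Z"
  shows "covariance M Z (\<lambda>\<omega>. X \<omega> + Y \<omega>) = covariance M Z X + covariance M Z Y"
  using covariance_add_left[OF assms] by (simp only: covariance_commute)

lemma covariance_sum_left:
  assumes "finite I" "\<And>i. i \<in> I \<Longrightarrow> square_integrable M (Y i)" "square_integrable M Z"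
  shows "covariance M (\<lambda>\<omega>. \<Sum>i\<in>I. c i * Y i \<omega>) Z = (\<Sum>i\<in>I. c i * covariance M (Y i) Z)"
  using assms(1,2)
proof (induction I rule: finite_induct)
  case empty
  show ?case by (simp add: covariance_def)
next
  case (insert i I)
  have "covariance M (\<lambda>\<omega>. c i * Y i \<omega>) Z = c i * covariance M (Y i) Z"
    using insert.prems assms(3)
    by (simp add: covariance_eq_expectation_mult square_integrable_cmult mult.assoc right_diff_distrib)
  then show ?case
    using insert assms(3)
    by (simp add: covariance_add_left square_integrable_sum square_integrable_cmult)
qed

lemma covariance_sum_right:
  assumes "finite I" "\<And>i. i \<in> I \<Longrightarrow> square_integrable M (Y i)" "square_integrable M Z"
  shows "covariance M Z (\<lambda>\<omega>. \<Sum>i\<in>I. c i * Y i \<omega>) = (\<Sum>i\<in>I. c i * covariance M Z (Y i))"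
  using covariance_sum_left[OF assms] by (simp only: covariance_commute)

text \<open>Bilinearity in both arguments. Reading the quadratic form as the variance of one random
  variable serves twice: for positive semidefiniteness and for the quadratic part of the
  objective.\<close>

lemma quadratic_form_covariance_mat:
  assumes "\<And>k. k < n \<Longrightarrow> square_integrable M (\<lambda>\<omega>. vec_index (Y \<omega>) k)" and x: "x \<in> carrier_vec n"
  shows "scalar_prod x (covariance_mat M n Y *\<^sub>v x)
    = covariance M (\<lambda>\<omega>. \<Sum>k<n. vec_index x k * vec_index (Y \<omega>) k)
        (\<lambda>\<omega>. \<Sum>k<n. vec_index x k * vec_index (Y \<omega>) k)"
proof -
  let ?L = "\<lambda>\<omega>. \<Sum>k<n. vec_index x k * vec_index (Y \<omega>) k"
  have "square_integrable M ?L"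
    using assms(1) by (intro square_integrable_sum square_integrable_cmult) simp
  then have "covariance M ?L ?L = (\<Sum>i<n. vec_index x i * (\<Sum>j<n. vec_index x j *
      covariance M (\<lambda>\<omega>. vec_index (Y \<omega>) i) (\<lambda>\<omega>. vec_index (Y \<omega>) j)))"
    using assms(1)
      covariance_sum_left[of "{..<n}" "\<lambda>k \<omega>. vec_index (Y \<omega>) k" ?L "vec_index x"]
      covariance_sum_right[of "{..<n}" "\<lambda>k \<omega>. vec_index (Y \<omega>) k" _ "vec_index x"]
    by simp
  then show ?thesis
    using x by (simp add: scalar_prod_def covariance_mat_def atLeast0LessThan mult.commute)
qed

text \<open>Symmetry is that of the covariance; the quadratic form is a variance, hence the
  expectation of a square.\<close>

lemma positive_semidefinite_covariance_mat:
  assumes "\<And>k. k < n \<Longrightarrow> square_integrable M (\<lambda>\<omega>. vec_index (Y \<omega>) k)"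
  shows "positive_semidefinite n (covariance_mat M n Y)"
proof -
  have "transpose_mat (covariance_mat M n Y) = covariance_mat M n Y"
    by (rule eq_matI) (auto simp: covariance_mat_def covariance_commute)
  moreover have "covariance_mat M n Y \<in> carrier_mat n n"
    by (simp add: covariance_mat_def)
  ultimately show ?thesis
    using assms
    by (simp add: positive_semidefinite_def quadratic_form_covariance_mat
        variance_eq_covariance[symmetric])
qed

text \<open>With L the linear combination, Var(Z + L) = Var Z + 2 Cov(L, Z) + Var L. The first term
  goes into the constant, the last is the quadratic form, and the cross term together with -lam E(L)
  is linear in \<open>x\<close>.\<close>

lemma portfolio_objective_add_linear:
  assumes Y: "\<And>k. k < n \<Longrightarrow> square_integrable M (\<lambda>\<omega>. vec_index (Y \<omega>) k)"
    and Z: "square_integrable M Z" and x: "x \<in> carrier_vec n"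
  shows "portfolio_objective M lam (\<lambda>\<omega>. Z \<omega> + (\<Sum>k<n. vec_index x k * vec_index (Y \<omega>) k))
    = portfolio_objective M lam Z + parameter_objective M lam n Y Z x"
proof -
  define L where "L = (\<lambda>\<omega>. \<Sum>k<n. vec_index x k * vec_index (Y \<omega>) k)"
  have L: "square_integrable M L"
    unfolding L_def by (intro square_integrable_sum square_integrable_cmult Y) simp
  \<comment> \<open>The two cross terms agree by symmetry; this is the source of the factor 2 in
    \<open>sigma_vec\<close>.\<close>
  have "covariance M (\<lambda>\<omega>. Z \<omega> + L \<omega>) (\<lambda>\<omega>. Z \<omega> + L \<omega>)
      = covariance M Z Z + 2 * covariance M L Z + covariance M L L"
    using Z L
    by (simp add: covariance_add_left covariance_add_right
        square_integrable_add covariance_commute[of Z L])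
  moreover have "covariance M L Z
      = (\<Sum>k<n. vec_index x k * covariance M (\<lambda>\<omega>. vec_index (Y \<omega>) k) Z)"
    using Y Z covariance_sum_left[of "{..<n}" "\<lambda>k \<omega>. vec_index (Y \<omega>) k" Z "vec_index x"]
    by (simp add: L_def)
  moreover have "expectation L = (\<Sum>k<n. vec_index x k * expectation (\<lambda>\<omega>. vec_index (Y \<omega>) k))"
    using Y unfolding L_def by (simp add: integrable_if_square_integrable)
  moreover have "expectation (\<lambda>\<omega>. Z \<omega> + L \<omega>) = expectation Z + expectation L"
    using Z L by (simp add: integrable_if_square_integrable)
  moreover have "scalar_prod x (lam \<cdot>\<^sub>v mean_vec M n Y - sigma_vec M n Y Z)
      = lam * (\<Sum>k<n. vec_index x k * expectation (\<lambda>\<omega>. vec_index (Y \<omega>) k))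
        - 2 * (\<Sum>k<n. vec_index x k * covariance M (\<lambda>\<omega>. vec_index (Y \<omega>) k) Z)"
    by (simp add: scalar_prod_def mean_vec_def sigma_vec_def atLeast0LessThan sum_distrib_left
        sum_subtractf [symmetric] algebra_simps)
  ultimately have "portfolio_objective M lam (\<lambda>\<omega>. Z \<omega> + L \<omega>)
      = portfolio_objective M lam Z + parameter_objective M lam n Y Z x"
    using quadratic_form_covariance_mat[OF Y x, folded L_def]
    unfolding portfolio_objective_def parameter_objective_def variance_eq_covariance
    by (simp add: algebra_simps)
  then show ?thesis
    by (simp add: L_def)
qed

lemma convex_quadratic_parameter_objective:
  assumes "\<And>k. k < n \<Longrightarrow> square_integrable M (\<lambda>\<omega>. vec_index (Y \<omega>) k)"
  shows "convex_quadratic_problem n (parameter_objective M lam n Y Z)"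
  unfolding convex_quadratic_problem_def
proof (intro exI conjI ballI)
  \<comment> \<open>The linear term is subtracted in \<open>parameter_objective\<close> but added in
    the standard form, so its coefficient vector changes sign.\<close>
  let ?b = "sigma_vec M n Y Z - lam \<cdot>\<^sub>v mean_vec M n Y"
  show "positive_semidefinite n (covariance_mat M n Y)"
    using assms by (rule positive_semidefinite_covariance_mat)
  show "?b \<in> carrier_vec n"
    by (simp add: sigma_vec_def mean_vec_def carrier_vecI)
  fix x :: "real vec" assume "x \<in> carrier_vec n"
  then show "parameter_objective M lam n Y Z x
      = scalar_prod x (covariance_mat M n Y *\<^sub>v x) + scalar_prod ?b x"
    by (simp add: parameter_objective_def scalar_prod_def sigma_vec_def mean_vec_def
        sum_subtractf sum.distrib algebra_simps)
qed

end

section \<open>Linear path-functional portfolios: their returns and their feasibility\<close>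

lemma holding_return_linear_weights:
  "holding_return U P t \<Delta> (linear_weights ty U V \<tau> X \<phi> l) \<omega>
    = holding_return U P t \<Delta> \<tau> \<omega>
      + (\<Sum>i\<in>U. \<Sum>\<nu>\<in>V. l i \<nu> * feature_return ty U P \<tau> X \<phi> t \<Delta> i \<nu> \<omega>)"
proof -
  define r where "r j = P j (t + \<Delta>) \<omega> / P j t \<omega>" for j
  define f where "f j = (\<Sum>\<nu>\<in>V. l j \<nu> * \<phi> \<nu> t (path_upto X t \<omega>))" for j
  \<comment> \<open>\<open>H\<close> is the gross return of \<open>\<tau>\<close>, one more than its
    holding return, so the bracket in \<open>feature_return\<close> becomes
    \<open>r i - H\<close>.\<close>
  define H where "H = (\<Sum>j\<in>U. \<tau> j t \<omega> * r j)"
  have cf: "controlling_function U V \<phi> l j t (path_upto X t \<omega>) = f j" if "j \<in> U" for j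
    using that by (simp add: controlling_function_def f_def)
  \<comment> \<open>Common form of both types: direct positions \<open>g j\<close>, with the
    remainder \<open>1 - sum g U\<close> placed in \<open>\<tau>\<close>. A position
    \<open>g j\<close> thus earns \<open>r j\<close> and gives up \<open>H\<close>.\<close>
  have affine: "(\<Sum>j\<in>U. (g j + \<tau> j t \<omega> * (1 - sum g U)) * r j)
      = H + (\<Sum>j\<in>U. g j * (r j - H))" for g
  proof -
    have "(\<Sum>j\<in>U. (g j + \<tau> j t \<omega> * (1 - sum g U)) * r j)
        = (\<Sum>j\<in>U. g j * r j) + (1 - sum g U) * H"
      unfolding H_def sum_distrib_left sum.distrib[symmetric]
      by (rule sum.cong) (simp_all add: algebra_simps)
    also have "\<dots> = H + (\<Sum>j\<in>U. g j * (r j - H))"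
      by (simp add: right_diff_distrib sum_subtractf sum_distrib_right left_diff_distrib)
    finally show ?thesis .
  qed
  show ?thesis
  proof (cases ty)
    case TypeI
    have "feature_return ty U P \<tau> X \<phi> t \<Delta> i \<nu> \<omega>
        = \<tau> i t \<omega> * \<phi> \<nu> t (path_upto X t \<omega>) * (r i - H)" for i \<nu>
      by (simp add: TypeI holding_return_def r_def H_def)
    then have "(\<Sum>\<nu>\<in>V. l i \<nu> * feature_return ty U P \<tau> X \<phi> t \<Delta> i \<nu> \<omega>)
        = \<tau> i t \<omega> * f i * (r i - H)" for i
      by (simp add: f_def sum_distrib_left sum_distrib_right mult_ac)
    \<comment> \<open>Type I has the common form with \<open>g j\<close> equal to
      \<open>\<tau> j t \<omega> * f j\<close>; type II has it with \<open>g = f\<close>.\<close>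
    moreover have "holding_return U P t \<Delta> (linear_weights ty U V \<tau> X \<phi> l) \<omega>
        = (\<Sum>j\<in>U. (\<tau> j t \<omega> * f j + \<tau> j t \<omega> * (1 - (\<Sum>j\<in>U. \<tau> j t \<omega> * f j))) * r j) - 1"
      by (simp add: TypeI holding_return_def linear_weights_def cf r_def algebra_simps)
    ultimately show ?thesis
      by (simp add: affine) (simp add: holding_return_def r_def H_def)
  next
    case TypeII
    have "feature_return ty U P \<tau> X \<phi> t \<Delta> i \<nu> \<omega>
        = \<phi> \<nu> t (path_upto X t \<omega>) * (r i - H)" for i \<nu>
      by (simp add: TypeII holding_return_def r_def H_def)
    then have "(\<Sum>\<nu>\<in>V. l i \<nu> * feature_return ty U P \<tau> X \<phi> t \<Delta> i \<nu> \<omega>)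
        = f i * (r i - H)" for i
      by (simp add: f_def sum_distrib_left sum_distrib_right mult_ac)
    moreover have "holding_return U P t \<Delta> (linear_weights ty U V \<tau> X \<phi> l) \<omega>
        = (\<Sum>j\<in>U. (f j + \<tau> j t \<omega> * (1 - sum f U)) * r j) - 1"
      by (simp add: TypeII holding_return_def linear_weights_def cf r_def)
    ultimately show ?thesis
      by (simp add: affine) (simp add: holding_return_def r_def H_def)
  qed
qed

text \<open>Outside \<open>U\<close> both the controlling functions and \<open>\<tau>\<close>
  vanish, which kills the weights of either type. This settles one of the constraints in
  \<open>linear_path_portfolios\<close>.\<close>

lemma invests_in_linear_weights:
  assumes "invests_in M T d U \<tau>"
  shows "invests_in M T d U (linear_weights ty U V \<tau> X \<phi> l)"
  using assms
  by (cases ty) (auto simp: invests_in_def linear_weights_def controlling_function_def)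

section \<open>Parameter families as vectors, and transport of minimizers\<close>

lemma stack_carrier [simp]: "stack U V \<L> a \<in> carrier_vec (card U * card V)"
  by (simp add: stack_def)

lemma scalar_prod_stack:
  assumes "bij_betw \<L> (U \<times> V) {1..card U * card V}"
  shows "(\<Sum>k<card U * card V. vec_index (stack U V \<L> a) k * vec_index (stack U V \<L> b) k)
    = (\<Sum>i\<in>U. \<Sum>\<nu>\<in>V. a i \<nu> * b i \<nu>)"
proof -
  let ?g = "\<lambda>k. vec_index (stack U V \<L> a) k * vec_index (stack U V \<L> b) k"
  have "(\<Sum>k<card U * card V. ?g k) = (\<Sum>k\<in>{1..card U * card V}. ?g (k - 1))"
    \<comment> \<open>Shift from vector positions, counted from 0, to values of \<open>\<L>\<close>,
      counted from 1; only then can the sum be reindexed along \<open>\<L>\<close>.\<close>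
    by (rule sum.reindex_bij_witness[of _ "\<lambda>k. k - 1" Suc]) auto
  also have "\<dots> = (\<Sum>p\<in>U \<times> V. ?g (\<L> p - 1))"
    by (rule sum.reindex_bij_betw[OF assms, symmetric])
  also have "\<dots> = (\<Sum>p\<in>U \<times> V. case p of (i, \<nu>) \<Rightarrow> a i \<nu> * b i \<nu>)"
    by (rule sum.cong) (auto simp: stack_index[OF assms] simp del: One_nat_def)
  finally show ?thesis
    by (simp add: sum.cartesian_product)
qed

lemma stack_surj:
  assumes "bij_betw \<L> (U \<times> V) {1..card U * card V}" "x \<in> carrier_vec (card U * card V)"
  obtains a where "stack U V \<L> a = x"
proof
  \<comment> \<open>The preimage reads each parameter off its own entry of \<open>x\<close>. Since
    \<open>Suc k\<close> lies in the range of \<open>\<L>\<close>, applying \<open>\<L>\<close>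
    after its inverse returns \<open>Suc k\<close>, hence entry \<open>k\<close>.\<close>
  show "stack U V \<L> (\<lambda>i \<nu>. vec_index x (\<L> (i, \<nu>) - 1)) = x"
  proof (rule eq_vecI)
    fix k assume "k < dim_vec x"
    then have "Suc k \<in> \<L> ` (U \<times> V)" "k < card U * card V"
      using assms by (auto simp: bij_betw_def)
    then show "vec_index (stack U V \<L> (\<lambda>i \<nu>. vec_index x (\<L> (i, \<nu>) - 1))) k = vec_index x k"
      by (simp add: stack_def case_prod_beta f_inv_into_f del: image_eqI)
  qed (use assms in \<open>simp add: stack_def\<close>)
qed

text \<open>Both feasible sets are ranges over the same parameters, and the objectives differ by the
  constant \<open>c\<close>, so all comparisons of values agree. Distinct parameters giving the same
  portfolio do no harm, because only values are compared.\<close>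

lemma is_arg_min_reparametrize:
  fixes q :: "'b \<Rightarrow> real"
  assumes "\<And>y. P y \<longleftrightarrow> (\<exists>l. y = g l)" "\<And>x. Q x \<longleftrightarrow> (\<exists>l. x = h l)"
    and "\<And>l. f (g l) = c + q (h l)"
  shows "is_arg_min f P (g l) \<longleftrightarrow> is_arg_min q Q (h l)"
  using assms by (auto simp: is_arg_min_def)

text \<open>Returns and relative returns differ only in the family \<open>P\<close> whose ratios
  enter, so a single argument for a fixed \<open>P\<close> covers both problems.\<close>

theorem corollary5p7:
  fixes M :: "'w measure" and F :: "real \<Rightarrow> 'w measure" and T lam t \<Delta> :: real and d :: nat
    and S R \<tau> :: "nat \<Rightarrow> real \<Rightarrow> 'w \<Rightarrow> real" and U :: "nat set"
    and X :: "real \<Rightarrow> 'w \<Rightarrow> 'x::euclidean_space"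
    and V :: "'v set" and \<phi> :: "'v \<Rightarrow> real \<Rightarrow> (real \<Rightarrow> 'x) \<Rightarrow> real"
    and ty :: portfolio_type and \<L> :: "nat \<times> 'v \<Rightarrow> nat"
  assumes "filtered_prob_space M F T"
    and "\<And>i. i \<in> {1..d} \<Longrightarrow> positive_continuous_semimartingale M F T (S i)"
    and "\<And>i. i \<in> {1..d} \<Longrightarrow> return_process M F T (S i) (R i)"
    and "U \<subseteq> {1..d}"
    and "portfolio M F T d R \<tau>" "invests_in M T d U \<tau>" "uniformly_bounded_portfolio M T d \<tau>"
    and "continuous_semimartingale_vec M F T X"
    and "finite V"
    and "\<And>l. portfolio M F T d R (linear_weights ty U V \<tau> X \<phi> l)"
    and "bij_betw \<L> (U \<times> V) {1..card U * card V}"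
    and "0 \<le> lam" "0 \<le> t" "t < t + \<Delta>" "t + \<Delta> \<le> T"
    and "\<And>P. P \<in> {S, universe_weight U S} \<Longrightarrow> square_integrable M (holding_return U P t \<Delta> \<tau>)"
    and "\<And>P i \<nu>. P \<in> {S, universe_weight U S} \<Longrightarrow> i \<in> U \<Longrightarrow> \<nu> \<in> V \<Longrightarrow>
           square_integrable M (feature_return ty U P \<tau> X \<phi> t \<Delta> i \<nu>)"
  shows "\<forall>P\<in>{S, universe_weight U S}.
    let N = card U * card V;
        Y = (\<lambda>\<omega>. stack U V \<L> (\<lambda>i \<nu>. feature_return ty U P \<tau> X \<phi> t \<Delta> i \<nu> \<omega>));
        q = parameter_objective M lam N Y (holding_return U P t \<Delta> \<tau>)
    in convex_quadratic_problem N q \<and>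
       (\<forall>l. is_arg_min (\<lambda>\<pi>. portfolio_objective M lam (holding_return U P t \<Delta> \<pi>))
               (\<lambda>\<pi>. \<pi> \<in> linear_path_portfolios M F T d R ty U V \<tau> X \<phi>)
               (linear_weights ty U V \<tau> X \<phi> l) \<longleftrightarrow>
             is_arg_min q (\<lambda>x. x \<in> carrier_vec N) (stack U V \<L> l))"
proof (rule ballI, unfold Let_def, rule conjI)
  interpret filtered_prob_space M F T by fact
  fix P assume P: "P \<in> {S, universe_weight U S}"
  let ?N = "card U * card V"
  let ?Y = "\<lambda>\<omega>. stack U V \<L> (\<lambda>i \<nu>. feature_return ty U P \<tau> X \<phi> t \<Delta> i \<nu> \<omega>)"
  let ?Z = "holding_return U P t \<Delta> \<tau>"
  let ?q = "parameter_objective M lam ?N ?Y ?Z"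
  have Y: "square_integrable M (\<lambda>\<omega>. vec_index (?Y \<omega>) k)" if "k < ?N" for k
  proof -
    have "Suc k \<in> \<L> ` (U \<times> V)"
      using that assms(11) by (auto simp: bij_betw_def)
    then obtain i \<nu> where "i \<in> U" "\<nu> \<in> V" "k = \<L> (i, \<nu>) - 1"
      by force
    then show ?thesis
      using assms(17)[OF P] by (simp add: stack_index[OF assms(11)] del: One_nat_def)
  qed
  show "convex_quadratic_problem ?N ?q"
    by (rule convex_quadratic_parameter_objective[OF Y])
  \<comment> \<open>The additive constant is the objective of \<open>\<tau>\<close> itself, the
    portfolio obtained for \<open>l = 0\<close>.\<close>
  have obj: "portfolio_objective M lam (holding_return U P t \<Delta> (linear_weights ty U V \<tau> X \<phi> l))
      = portfolio_objective M lam ?Z + ?q (stack U V \<L> l)" for l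
  proof -
    have "holding_return U P t \<Delta> (linear_weights ty U V \<tau> X \<phi> l)
        = (\<lambda>\<omega>. ?Z \<omega> + (\<Sum>k<?N. vec_index (stack U V \<L> l) k * vec_index (?Y \<omega>) k))"
      by (simp add: fun_eq_iff holding_return_linear_weights scalar_prod_stack[OF assms(11)])
    then show ?thesis
      using portfolio_objective_add_linear[OF Y assms(16)[OF P] stack_carrier, where lam = lam] by simp
  qed
  \<comment> \<open>Every parameter family is assumed to give a portfolio, so the left problem is
    unconstrained in \<open>l\<close>; surjectivity of \<open>stack\<close> makes the right one
    range over the same families.\<close>
  have feasible: "\<pi> \<in> linear_path_portfolios M F T d R ty U V \<tau> X \<phi>
      \<longleftrightarrow> (\<exists>l. \<pi> = linear_weights ty U V \<tau> X \<phi> l)" for \<pi>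
    using assms(10) invests_in_linear_weights[OF assms(6)]
    by (auto simp: linear_path_portfolios_def)
  have stack: "x \<in> carrier_vec ?N \<longleftrightarrow> (\<exists>l. x = stack U V \<L> l)" for x
    using stack_surj[OF assms(11)] by (metis stack_carrier)
  show "\<forall>l. is_arg_min (\<lambda>\<pi>. portfolio_objective M lam (holding_return U P t \<Delta> \<pi>))
         (\<lambda>\<pi>. \<pi> \<in> linear_path_portfolios M F T d R ty U V \<tau> X \<phi>)
         (linear_weights ty U V \<tau> X \<phi> l) \<longleftrightarrow>
       is_arg_min ?q (\<lambda>x. x \<in> carrier_vec ?N) (stack U V \<L> l)"
    by (intro allI is_arg_min_reparametrize[where g = "linear_weights ty U V \<tau> X \<phi>"
          and h = "stack U V \<L>" and c = "portfolio_objective M lam ?Z"] feasible stack obj)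
qed

end
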